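(* For any graph $G$ with no isolated vertex and any nontrivial graph $H$, $$\gamma_{\times 2}(G\circ H)=\gamma_{t\{R2\}}(G\circ H).$$
   Context: All graphs are finite, undirected, without loops or multiple edges, and have at least one vertex; a graph is nontrivial if it has at least two vertices. $N(v)$ denotes the open neighbourhood of $v$ (the set of vertices adjacent to $v$). The lexicographic product $G\circ H$ has vertex set $V(G)\times V(H)$, and $(u,v)$ is adjacent to $(x,y)$ if and only if $ux\in E(G)$, or $u=x$ and $vy\in E(H)$. A vertex dominates itself and its neighbours. For a graph $F$ with no isolated vertex, a double dominating set of $F$ is a set $S\subseteq V(F)$ such that every vertex of $F$ is dominated by at least two vertices of $S$; $\gamma_{\times 2}(F)$ is the minimum cardinality of a double dominating set of $F$. A total dominating set of $F$ is a set $S\subseteq V(F)$ such that every vertex of $F$ (including those in $S$) has a neighbour in $S$. A total Roman $\{2\}$-dominating function on $F$ is a function $f:V(F)\to\{0,1,2\}$ such that $\{v: f(v)\ge 1\}$ is a total dominating set of $F$ and $\sum_{w\in N(v)}f(w)\ge 2$ for every $v$ with $f(v)=0$; its weight is $\sum_{v\in V(F)}f(v)$. $\gamma_{t\{R2\}}(F)$ is the minimum weight of a total Roman $\{2\}$-dominating function on $F$. *)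

theory Defs
  imports "Graph_Theory.Pair_Digraph"
begin

text \<open>
  A finite simple undirected graph is a \<^locale>\<open>pair_graph\<close>: finite, loopless, with a symmetric
  set of arcs, so that an edge \<open>uv\<close> is the pair of arcs \<open>(u,v)\<close>, \<open>(v,u)\<close>. This locale admits the
  null graph; non-emptiness of the vertex set is therefore a separate hypothesis.
\<close>

definition nbhd :: "'a pair_pre_digraph \<Rightarrow> 'a \<Rightarrow> 'a set" where
  "nbhd F v = {w. (v, w) \<in> parcs F}"

definition no_isolated_vertex :: "'a pair_pre_digraph \<Rightarrow> bool" where
  "no_isolated_vertex F \<longleftrightarrow> (\<forall>v \<in> pverts F. nbhd F v \<noteq> {})"

definition lex_product ::
  "'a pair_pre_digraph \<Rightarrow> 'b pair_pre_digraph \<Rightarrow> ('a \<times> 'b) pair_pre_digraph" where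
  "lex_product G H =
    \<lparr> pverts = pverts G \<times> pverts H,
      parcs = {((u, v), (x, y)) | u v x y.
                 u \<in> pverts G \<and> v \<in> pverts H \<and> x \<in> pverts G \<and> y \<in> pverts H \<and>
                 ((u, x) \<in> parcs G \<or> u = x \<and> (v, y) \<in> parcs H)} \<rparr>"

text \<open>The name \<open>dominates\<close> is taken by the adjacency abbreviation of the graph library.\<close>

definition vertex_dominates :: "'a pair_pre_digraph \<Rightarrow> 'a \<Rightarrow> 'a \<Rightarrow> bool" where
  "vertex_dominates F u v \<longleftrightarrow> v = u \<or> v \<in> nbhd F u"

definition double_dominating_set :: "'a pair_pre_digraph \<Rightarrow> 'a set \<Rightarrow> bool" where
  "double_dominating_set F S \<longleftrightarrow>
    S \<subseteq> pverts F \<and> (\<forall>v \<in> pverts F. 2 \<le> card {u \<in> S. vertex_dominates F u v})"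

definition double_domination_number :: "'a pair_pre_digraph \<Rightarrow> nat" where
  "double_domination_number F = (LEAST k. \<exists>S. double_dominating_set F S \<and> card S = k)"

definition total_dominating_set :: "'a pair_pre_digraph \<Rightarrow> 'a set \<Rightarrow> bool" where
  "total_dominating_set F S \<longleftrightarrow>
    S \<subseteq> pverts F \<and> (\<forall>v \<in> pverts F. \<exists>w \<in> S. w \<in> nbhd F v)"

text \<open>Values of \<open>f\<close> outside \<open>pverts F\<close> are unconstrained and have no influence.\<close>

definition total_roman2_dominating_function :: "'a pair_pre_digraph \<Rightarrow> ('a \<Rightarrow> nat) \<Rightarrow> bool" where
  "total_roman2_dominating_function F f \<longleftrightarrow>
    f ` pverts F \<subseteq> {0, 1, 2} \<and>
    total_dominating_set F {v \<in> pverts F. 1 \<le> f v} \<and>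
    (\<forall>v \<in> pverts F. f v = 0 \<longrightarrow> 2 \<le> (\<Sum>w \<in> nbhd F v. f w))"

definition total_roman2_domination_number :: "'a pair_pre_digraph \<Rightarrow> nat" where
  "total_roman2_domination_number F =
    (LEAST k. \<exists>f. total_roman2_dominating_function F f \<and> (\<Sum>v \<in> pverts F. f v) = k)"

lemma pair_graph_lex_product:
  assumes "pair_graph G" and "pair_graph H"
  shows "pair_graph (lex_product G H)"
proof -
  interpret G: pair_graph G by fact
  interpret H: pair_graph H by fact
  let ?P = "lex_product G H"
  have sub: "parcs ?P \<subseteq> pverts ?P \<times> pverts ?P"
    by (auto simp: lex_product_def)
  have fin: "finite (pverts ?P)"
    by (simp add: lex_product_def G.pair_finite_verts H.pair_finite_verts)
  have "finite (parcs ?P)"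
    using finite_subset[OF sub] fin by simp
  moreover have "sym (parcs ?P)"
    by (auto simp: lex_product_def sym_def dest: G.arcs_symmetric H.arcs_symmetric)
  moreover have "fst e \<noteq> snd e" if "e \<in> parcs ?P" for e
    using that by (auto simp: lex_product_def dest: G.no_loops' H.no_loops')
  ultimately show ?thesis
    using sub fin by unfold_locales (auto simp: symmetric_def)
qed

lemma no_isolated_vertex_lex_product:
  assumes "pair_graph G" and "no_isolated_vertex G"
  shows "no_isolated_vertex (lex_product G H)"
proof -
  interpret G: pair_graph G by fact
  have "\<exists>q. (p, q) \<in> parcs (lex_product G H)" if p: "p \<in> pverts (lex_product G H)" for p
  proof -
    obtain u v where uv: "p = (u, v)" "u \<in> pverts G" "v \<in> pverts H"
      using p by (auto simp: lex_product_def)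
    then obtain x where x: "(u, x) \<in> parcs G"
      using assms(2) by (auto simp: no_isolated_vertex_def nbhd_def)
    have "(p, (x, v)) \<in> parcs (lex_product G H)"
      using uv x G.in_arcsD2[OF x] by (simp add: lex_product_def)
    then show ?thesis ..
  qed
  then show ?thesis
    by (auto simp: no_isolated_vertex_def nbhd_def)
qed

text \<open>Both minima range over nonempty sets when there is no isolated vertex.\<close>

lemma double_dominating_set_pverts:
  assumes "pair_graph F" and "no_isolated_vertex F"
  shows "double_dominating_set F (pverts F)"
  unfolding double_dominating_set_def
proof (intro conjI ballI subset_refl)
  interpret F: pair_graph F by fact
  fix v assume v: "v \<in> pverts F"
  then obtain w where w: "(v, w) \<in> parcs F"
    using assms(2) by (auto simp: no_isolated_vertex_def nbhd_def)
  have "{v, w} \<subseteq> {u \<in> pverts F. vertex_dominates F u v}"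
    using v w F.arcs_symmetric[OF w]
    by (auto simp: vertex_dominates_def nbhd_def dest: F.in_arcsD2)
  then have "card {v, w} \<le> card {u \<in> pverts F. vertex_dominates F u v}"
    by (rule card_mono[rotated]) (simp add: F.pair_finite_verts)
  then show "2 \<le> card {u \<in> pverts F. vertex_dominates F u v}"
    using F.no_loops'[OF w] by simp
qed

lemma total_roman2_dominating_function_one:
  assumes "pair_graph F" and "no_isolated_vertex F"
  shows "total_roman2_dominating_function F (\<lambda>_. 1)"
proof -
  interpret F: pair_graph F by fact
  have "\<exists>w \<in> pverts F. (v, w) \<in> parcs F" if v: "v \<in> pverts F" for v
  proof -
    obtain w where w: "(v, w) \<in> parcs F"
      using assms(2) v by (auto simp: no_isolated_vertex_def nbhd_def)
    then show ?thesis
      using F.in_arcsD2[OF w] by blast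
  qed
  then show ?thesis
    by (auto simp: total_roman2_dominating_function_def total_dominating_set_def nbhd_def)
qed

end

theory Submission
  imports Defs
begin

text \<open>
  The indicator function of a double dominating set is a total Roman \<open>{2}\<close>-dominating function.
  Conversely, given a total Roman \<open>{2}\<close>-dominating function \<open>f\<close> on the product, one adds to its
  support one vertex \<open>q p\<close> for each vertex \<open>p\<close> of value 2, which does not exceed the weight. If some
  vertex in a fibre adjacent to that of \<open>p\<close> has positive value, \<open>q p\<close> is another vertex in the fibre
  of \<open>p\<close>; otherwise the support within the fibre of \<open>p\<close> contains a neighbour of \<open>p\<close>, and \<open>q p\<close> is
  taken in an adjacent fibre. Either way every neighbour of \<open>p\<close> has a second neighbour in the
  enlarged support.
\<close>

lemma two_le_card:
  assumes "finite A" and "a \<in> A" and "b \<in> A" and "a \<noteq> b"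
  shows "2 \<le> card A"
  using card_mono[of A "{a, b}"] assms by simp

lemma two_le_cardE:
  assumes "2 \<le> card A"
  obtains b where "b \<in> A" and "b \<noteq> a"
proof -
  have "\<not> A \<subseteq> {a}"
    using assms card_mono[of "{a}" A] by auto
  then show thesis
    using that by blast
qed

section \<open>Double domination and total Roman {2}-domination in an arbitrary graph\<close>

context pair_graph
begin

lemma nbhd_subset_pverts: "nbhd G v \<subseteq> pverts G"
  by (auto simp: nbhd_def dest: in_arcsD2)

lemma finite_nbhd: "finite (nbhd G v)"
  using finite_subset[OF nbhd_subset_pverts pair_finite_verts] .

lemma nbhd_commute: "w \<in> nbhd G v \<longleftrightarrow> v \<in> nbhd G w"
  by (auto simp: nbhd_def dest: arcs_symmetric)

lemma not_in_nbhd_self: "v \<notin> nbhd G v"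
  by (auto simp: nbhd_def dest: no_loops')

text \<open>A vertex of \<open>S\<close> dominates itself, so it needs only one neighbour in
  \<open>S\<close>; a vertex outside \<open>S\<close> must find both of its dominators among its
  neighbours.\<close>

lemma double_dominating_set_iff:
  "double_dominating_set G S \<longleftrightarrow>
    S \<subseteq> pverts G \<and> (\<forall>v \<in> S. nbhd G v \<inter> S \<noteq> {}) \<and>
    (\<forall>v \<in> pverts G - S. 2 \<le> card (nbhd G v \<inter> S))"
proof (cases "S \<subseteq> pverts G")
  case S: True
  have inside: "2 \<le> card {u \<in> S. vertex_dominates G u v} \<longleftrightarrow> nbhd G v \<inter> S \<noteq> {}"
    if "v \<in> S" for v
  proof -
    have "{u \<in> S. vertex_dominates G u v} = insert v (nbhd G v \<inter> S)"
      using that by (auto simp: vertex_dominates_def nbhd_commute)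
    then have "card {u \<in> S. vertex_dominates G u v} = Suc (card (nbhd G v \<inter> S))"
      using finite_nbhd not_in_nbhd_self by simp
    then show ?thesis
      using finite_nbhd[of v] by (simp add: Suc_le_eq card_gt_0_iff numeral_2_eq_2)
  qed
  have outside: "{u \<in> S. vertex_dominates G u v} = nbhd G v \<inter> S" if "v \<notin> S" for v
    using that by (auto simp: vertex_dominates_def nbhd_commute)
  show ?thesis
    unfolding double_dominating_set_def using S inside outside
    by (metis DiffD1 DiffD2 DiffI subsetD)
qed (simp add: double_dominating_set_def)

text \<open>By \<open>double_dominating_set_iff\<close> every vertex, inside or outside
  \<open>S\<close>, has a neighbour in \<open>S\<close>. At a vertex of value 0 the sum of the
  indicator over the neighbourhood counts the neighbours in \<open>S\<close>.\<close>

lemma total_roman2_dominating_function_indicator: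
  assumes "double_dominating_set G S"
  shows "total_roman2_dominating_function G (\<lambda>v. of_bool (v \<in> S))"
proof -
  have S: "S \<subseteq> pverts G" "\<And>v. v \<in> S \<Longrightarrow> nbhd G v \<inter> S \<noteq> {}"
    and two: "\<And>v. v \<in> pverts G - S \<Longrightarrow> 2 \<le> card (nbhd G v \<inter> S)"
    using assms by (auto simp: double_dominating_set_iff)
  have "nbhd G v \<inter> S \<noteq> {}" if "v \<in> pverts G" for v
    using that S(2)[of v] two[of v] by (cases "v \<in> S") auto
  then have "total_dominating_set G S"
    using S(1) by (auto simp: total_dominating_set_def)
  moreover have "{v \<in> pverts G. 1 \<le> (of_bool (v \<in> S) :: nat)} = S"
    using S(1) by auto
  moreover have "(\<Sum>w \<in> nbhd G v. of_bool (w \<in> S)) = card (nbhd G v \<inter> S)" for v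
    using finite_nbhd by (simp add: Int_def)
  ultimately show ?thesis
    using two by (auto simp: total_roman2_dominating_function_def)
qed

text \<open>Hypothesis \<open>q\<close> is the only place where the structure of the product will
  enter. A vertex outside the support can fail to have two neighbours in it only if it has a
  neighbour of value 2, and \<open>q\<close> repairs exactly this.\<close>

lemma exists_double_dominating_set_card_le:
  assumes f: "total_roman2_dominating_function G f"
    and q: "\<And>p. p \<in> pverts G \<Longrightarrow> f p = 2 \<Longrightarrow> \<exists>q \<in> pverts G.
      \<forall>r \<in> nbhd G p. \<exists>s \<in> nbhd G r. s \<noteq> p \<and> (s = q \<or> 1 \<le> f s)"
  shows "\<exists>S. double_dominating_set G S \<and> card S \<le> (\<Sum>v \<in> pverts G. f v)"
proof -
  define T where "T = {v \<in> pverts G. f v = 2}"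
  define P where "P = {v \<in> pverts G. 1 \<le> f v}"
  have "\<forall>p \<in> T. \<exists>q. q \<in> pverts G \<and>
      (\<forall>r \<in> nbhd G p. \<exists>s \<in> nbhd G r. s \<noteq> p \<and> (s = q \<or> 1 \<le> f s))"
    using q by (auto simp: T_def Bex_def)
  then obtain h where h: "\<And>p. p \<in> T \<Longrightarrow> h p \<in> pverts G"
    "\<And>p r. p \<in> T \<Longrightarrow> r \<in> nbhd G p \<Longrightarrow> \<exists>s \<in> nbhd G r. s \<noteq> p \<and> (s = h p \<or> 1 \<le> f s)"
    by metis
  define S where "S = P \<union> h ` T"
  have range: "f v = 0 \<or> f v = 1 \<or> f v = 2" if "v \<in> pverts G" for v
    using f that by (auto simp: total_roman2_dominating_function_def)
  have finP: "finite P" and finT: "finite T"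
    by (simp_all add: P_def T_def pair_finite_verts)
  \<comment> \<open>\<open>h\<close> need not be injective and may take values in \<open>P\<close>,
    so this is only an upper bound.\<close>
  have "card S \<le> card P + card T"
    unfolding S_def by (meson add_left_mono card_Un_le card_image_le finT le_trans)
  \<comment> \<open>A vertex of value 2 is counted twice, once in \<open>P\<close> and once in
    \<open>T\<close>.\<close>
  also have "\<dots> = (\<Sum>v \<in> pverts G. of_bool (1 \<le> f v) + of_bool (f v = 2))"
    by (simp add: P_def T_def sum.distrib pair_finite_verts Int_def)
  also have "\<dots> = (\<Sum>v \<in> pverts G. f v)"
    by (rule sum.cong) (use range in fastforce)+
  finally have card: "card S \<le> (\<Sum>v \<in> pverts G. f v)" .
  have S: "S \<subseteq> pverts G"
    using h(1) by (auto simp: S_def P_def)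
  have "nbhd G v \<inter> S \<noteq> {}" if "v \<in> S" for v
  proof -
    \<comment> \<open>Total domination speaks of all vertices, so the added vertices
      \<open>h p\<close> also have a neighbour in \<open>P\<close>.\<close>
    have "\<exists>w \<in> P. w \<in> nbhd G v"
      using f that S
      by (auto simp: P_def total_roman2_dominating_function_def total_dominating_set_def)
    then show ?thesis
      by (auto simp: S_def)
  qed
  moreover have "2 \<le> card (nbhd G v \<inter> S)" if v: "v \<in> pverts G - S" for v
  proof (cases "nbhd G v \<inter> T = {}")
    case True
    have "f v = 0"
      using v by (auto simp: S_def P_def)
    then have "2 \<le> (\<Sum>w \<in> nbhd G v. f w)"
      using f v by (auto simp: total_roman2_dominating_function_def)
    \<comment> \<open>No neighbour of \<open>v\<close> has value 2, so each contributes at most 1 to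
      the sum, and those that contribute lie in \<open>S\<close>.\<close>
    also have "\<dots> \<le> (\<Sum>w \<in> nbhd G v. of_bool (w \<in> S))"
    proof (rule sum_mono)
      fix w assume "w \<in> nbhd G v"
      then show "f w \<le> of_bool (w \<in> S)"
        using True range[of w] nbhd_subset_pverts by (auto simp: S_def P_def T_def)
    qed
    also have "\<dots> = card (nbhd G v \<inter> S)"
      using finite_nbhd by (simp add: Int_def)
    finally show ?thesis .
  next
    case False
    then obtain p where p: "p \<in> T" "p \<in> nbhd G v"
      by auto
    then obtain s where s: "s \<in> nbhd G v" "s \<noteq> p" "s = h p \<or> 1 \<le> f s"
      using h(2)[of p v] nbhd_commute by blast
    have "s \<in> S" "p \<in> S"
      using s p nbhd_subset_pverts by (auto simp: S_def P_def T_def)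
    then show ?thesis
      using s p finite_nbhd by (intro two_le_card[of _ s p]) auto
  qed
  ultimately show ?thesis
    using S card by (auto simp: double_dominating_set_iff)
qed

end

section \<open>Second neighbours in lexicographic products\<close>

lemma pverts_lex_product: "pverts (lex_product G H) = pverts G \<times> pverts H"
  by (simp add: lex_product_def)

lemma nbhd_lex_product:
  assumes "pair_graph G" and "pair_graph H" and "u \<in> pverts G" and "v \<in> pverts H"
  shows "nbhd (lex_product G H) (u, v) = nbhd G u \<times> pverts H \<union> {u} \<times> nbhd H v"
  using assms pair_graph.nbhd_subset_pverts[OF assms(1), of u]
    pair_graph.nbhd_subset_pverts[OF assms(2), of v]
  by (auto simp: nbhd_def lex_product_def)

text \<open>A neighbour of \<open>p\<close> either lies in an adjacent fibre, and then is adjacent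
  to the whole fibre of \<open>p\<close>, or lies in the fibre of \<open>p\<close>, and then is
  adjacent to every vertex of the adjacent fibres. Hence it suffices to have one vertex other than
  \<open>p\<close> in the fibre of \<open>p\<close> and one in an adjacent fibre; \<open>P\<close>
  supplies one of them and \<open>q\<close> the other.\<close>

lemma lex_product_second_neighbour:
  assumes G: "pair_graph G" and iso: "no_isolated_vertex G"
    and H: "pair_graph H" and card: "2 \<le> card (pverts H)"
    and P: "total_dominating_set (lex_product G H) P"
    and p: "p \<in> pverts (lex_product G H)"
  shows "\<exists>q \<in> pverts (lex_product G H). \<forall>r \<in> nbhd (lex_product G H) p.
    \<exists>s \<in> nbhd (lex_product G H) r. s \<noteq> p \<and> (s = q \<or> s \<in> P)"
proof -
  interpret G: pair_graph G by fact
  interpret H: pair_graph H by fact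
  note nbhd = nbhd_lex_product[OF G H]
  note sub = G.nbhd_subset_pverts H.nbhd_subset_pverts
  obtain u v where uv: "p = (u, v)" "u \<in> pverts G" "v \<in> pverts H"
    using p by (auto simp: pverts_lex_product)
  show ?thesis
  proof (cases "\<exists>x \<in> nbhd G u. \<exists>w \<in> pverts H. (x, w) \<in> P")
    case True
    then obtain x w where xw: "x \<in> nbhd G u" "w \<in> pverts H" "(x, w) \<in> P"
      by auto
    obtain v' where v': "v' \<in> pverts H" "v' \<noteq> v"
      using card by (rule two_le_cardE)
    have "\<exists>s \<in> nbhd (lex_product G H) r. s \<noteq> p \<and> (s = (u, v') \<or> s \<in> P)"
      if r_nbhd: "r \<in> nbhd (lex_product G H) p" for r
    proof -
      obtain a b where r: "r = (a, b)" by fastforce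
      consider "u \<in> nbhd G a" "a \<in> pverts G" "b \<in> pverts H" | "a = u" "b \<in> pverts H"
        using r_nbhd uv r sub G.nbhd_commute[of a u] by (auto simp: nbhd)
      then show ?thesis
      proof cases
        case 1
        then have "(u, v') \<in> nbhd (lex_product G H) r"
          using r v' by (auto simp: nbhd)
        then show ?thesis
          using v' uv by blast
      next
        case 2
        then have "(x, w) \<in> nbhd (lex_product G H) r" "x \<noteq> u"
          using r xw uv G.not_in_nbhd_self by (auto simp: nbhd)
        then show ?thesis
          using xw uv by blast
      qed
    qed
    then show ?thesis
      using uv v' by (intro bexI[of _ "(u, v')"]) (auto simp: pverts_lex_product)
  next
    case False
    obtain x where x: "x \<in> nbhd G u"
      using iso uv by (auto simp: no_isolated_vertex_def)
    obtain s where s: "s \<in> P" "s \<in> nbhd (lex_product G H) p"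
      using P p by (auto simp: total_dominating_set_def)
    \<comment> \<open>\<open>P\<close> misses all adjacent fibres in this case, so the neighbour of
      \<open>p\<close> given by total domination lies in the fibre of \<open>p\<close>; it differs
      from \<open>p\<close> because \<open>H\<close> has no loops.\<close>
    then obtain c where c: "s = (u, c)" "c \<in> nbhd H v"
      using False uv by (auto simp: nbhd)
    have "\<exists>s \<in> nbhd (lex_product G H) r. s \<noteq> p \<and> (s = (x, v) \<or> s \<in> P)"
      if r_nbhd: "r \<in> nbhd (lex_product G H) p" for r
    proof -
      obtain a b where r: "r = (a, b)" by fastforce
      consider "u \<in> nbhd G a" "a \<in> pverts G" "b \<in> pverts H" | "a = u" "b \<in> pverts H"
        using r_nbhd uv r sub G.nbhd_commute[of a u] by (auto simp: nbhd)
      then show ?thesis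
      proof cases
        case 1
        then have "s \<in> nbhd (lex_product G H) r" "s \<noteq> p"
          using r c uv sub H.not_in_nbhd_self by (auto simp: nbhd)
        then show ?thesis
          using s by blast
      next
        case 2
        then have "(x, v) \<in> nbhd (lex_product G H) r" "x \<noteq> u"
          using r x uv G.not_in_nbhd_self by (auto simp: nbhd)
        then show ?thesis
          using uv by blast
      qed
    qed
    then show ?thesis
      using uv x sub by (intro bexI[of _ "(x, v)"]) (auto simp: pverts_lex_product)
  qed
qed

theorem theorem2p1:
  fixes G :: "'a pair_pre_digraph" and H :: "'b pair_pre_digraph"
  assumes "pair_graph G" and "pverts G \<noteq> {}" and "no_isolated_vertex G"
    and "pair_graph H" and "2 \<le> card (pverts H)"
  shows "double_domination_number (lex_product G H) =
         total_roman2_domination_number (lex_product G H)"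
proof -
  let ?F = "lex_product G H"
  interpret F: pair_graph ?F
    using assms by (intro pair_graph_lex_product)
  note iso = no_isolated_vertex_lex_product[OF assms(1,3), of H]
  show ?thesis
  proof (rule antisym)
    \<comment> \<open>The constant function 1 shows that some weight exists, so the
      \<open>LEAST\<close> is attained; below, the full vertex set does the same for double
      domination.\<close>
    have "\<exists>k f. total_roman2_dominating_function ?F f \<and> (\<Sum>v \<in> pverts ?F. f v) = k"
      using total_roman2_dominating_function_one[OF F.pair_graph_axioms iso] by blast
    then obtain f where f: "total_roman2_dominating_function ?F f"
      and weight: "(\<Sum>v \<in> pverts ?F. f v) = total_roman2_domination_number ?F"
      unfolding total_roman2_domination_number_def by (elim LeastI_ex[THEN exE]) blast
    have P: "total_dominating_set ?F {v \<in> pverts ?F. 1 \<le> f v}"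
      using f by (simp add: total_roman2_dominating_function_def)
    have "\<exists>q \<in> pverts ?F. \<forall>r \<in> nbhd ?F p. \<exists>s \<in> nbhd ?F r. s \<noteq> p \<and> (s = q \<or> 1 \<le> f s)"
      if "p \<in> pverts ?F" for p
      using lex_product_second_neighbour[OF assms(1,3-5) P that] by blast
    then obtain S where "double_dominating_set ?F S" "card S \<le> (\<Sum>v \<in> pverts ?F. f v)"
      using F.exists_double_dominating_set_card_le[OF f] by blast
    moreover from this have "double_domination_number ?F \<le> card S"
      unfolding double_domination_number_def by (intro Least_le) blast
    ultimately show "double_domination_number ?F \<le> total_roman2_domination_number ?F"
      using weight by simp
  next
    have "\<exists>k S. double_dominating_set ?F S \<and> card S = k"
      using double_dominating_set_pverts[OF F.pair_graph_axioms iso] by blast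
    then obtain S where S: "double_dominating_set ?F S"
      and card: "card S = double_domination_number ?F"
      unfolding double_domination_number_def by (elim LeastI_ex[THEN exE]) blast
    have "pverts ?F \<inter> S = S"
      using S by (auto simp: double_dominating_set_def)
    then have "(\<Sum>v \<in> pverts ?F. of_bool (v \<in> S)) = card S"
      using F.pair_finite_verts by (simp add: Int_def)
    then have "total_roman2_domination_number ?F \<le> card S"
      unfolding total_roman2_domination_number_def
      using F.total_roman2_dominating_function_indicator[OF S] by (intro Least_le) blast
    then show "total_roman2_domination_number ?F \<le> double_domination_number ?F"
      using card by simp
  qed
qed

end
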